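(* Let $n>1$ and let $\mathbf A_n$ be the set $\{x_0,x_1,\dots,x_{n-1}\}$ of $n$ distinct elements with multiplication $x_i\cdot x_j=x_{\max(j-i,0)}$ for all $i,j\in\{0,\dots,n-1\}$. Then $\mathbf A_n$ is a simple linear CKL-algebra (with $1=x_0$) with order $x_0>x_1>\dots>x_{n-1}$.
   Context: An L-algebra is a set $X$ with a binary operation $\cdot$ and a distinguished element $1$ such that for all $x,y,z\in X$: $1\cdot x=x$ and $x\cdot 1=x\cdot x=1$; $(x\cdot y)\cdot(x\cdot z)=(y\cdot x)\cdot(y\cdot z)$; and $x\cdot y=y\cdot x=1$ implies $x=y$. It is partially ordered by $x\le y\iff x\cdot y=1$; it is linear if this order is total. A CKL-algebra is an L-algebra with $x\cdot(y\cdot z)=y\cdot(x\cdot z)$ for all $x,y,z$. An ideal of $X$ is a nonempty subset $I\subseteq X$ such that for all $x\in I$, $y\in X$: (I1) $x\cdot y\in I$ implies $y\in I$; (I2) $y\cdot x\in I$; (I3) $(x\cdot y)\cdot y\in I$; (I4) $y\cdot(x\cdot y)\in I$. $X$ is simple if it has no ideals other than $\{1\}$ and $X$. *)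

theory Defs
  imports Main
begin

locale L_algebra =
  fixes X :: "'a set"
    and mul :: "'a \<Rightarrow> 'a \<Rightarrow> 'a"  (infixl "\<cdot>" 70)
    and one :: 'a  ("\<one>")
  assumes mul_closed: "x \<in> X \<Longrightarrow> y \<in> X \<Longrightarrow> x \<cdot> y \<in> X"
    and one_closed: "\<one> \<in> X"
    and one_mul: "x \<in> X \<Longrightarrow> \<one> \<cdot> x = x"
    and mul_one: "x \<in> X \<Longrightarrow> x \<cdot> \<one> = \<one>"
    and mul_self: "x \<in> X \<Longrightarrow> x \<cdot> x = \<one>"
    and cycloid:
      "x \<in> X \<Longrightarrow> y \<in> X \<Longrightarrow> z \<in> X \<Longrightarrow> (x \<cdot> y) \<cdot> (x \<cdot> z) = (y \<cdot> x) \<cdot> (y \<cdot> z)"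
    and mul_antisym:
      "x \<in> X \<Longrightarrow> y \<in> X \<Longrightarrow> x \<cdot> y = \<one> \<Longrightarrow> y \<cdot> x = \<one> \<Longrightarrow> x = y"

locale CKL_algebra = L_algebra +
  assumes mul_left_commute:
    "x \<in> X \<Longrightarrow> y \<in> X \<Longrightarrow> z \<in> X \<Longrightarrow> x \<cdot> (y \<cdot> z) = y \<cdot> (x \<cdot> z)"

definition L_le :: "('a \<Rightarrow> 'a \<Rightarrow> 'a) \<Rightarrow> 'a \<Rightarrow> 'a \<Rightarrow> 'a \<Rightarrow> bool" where
  "L_le mul e x y \<longleftrightarrow> mul x y = e"

definition L_less :: "('a \<Rightarrow> 'a \<Rightarrow> 'a) \<Rightarrow> 'a \<Rightarrow> 'a \<Rightarrow> 'a \<Rightarrow> bool" where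
  "L_less mul e x y \<longleftrightarrow> L_le mul e x y \<and> x \<noteq> y"

locale linear_L_algebra = L_algebra +
  assumes linear: "linear_order_on X {(x, y). x \<in> X \<and> y \<in> X \<and> L_le (\<cdot>) \<one> x y}"

definition L_ideal :: "'a set \<Rightarrow> ('a \<Rightarrow> 'a \<Rightarrow> 'a) \<Rightarrow> 'a set \<Rightarrow> bool" where
  "L_ideal X mul I \<longleftrightarrow> I \<noteq> {} \<and> I \<subseteq> X \<and>
     (\<forall>x\<in>I. \<forall>y\<in>X.
        (mul x y \<in> I \<longrightarrow> y \<in> I) \<and>
        mul y x \<in> I \<and>
        mul (mul x y) y \<in> I \<and>
        mul y (mul x y) \<in> I)"

text \<open>The one-element algebra counts as simple.\<close>

locale simple_L_algebra = L_algebra +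
  assumes simple: "L_ideal X (\<cdot>) I \<Longrightarrow> I = {\<one>} \<or> I = X"

end

theory Submission
  imports Defs
begin

text \<open>On indices the product is truncated subtraction, \<open>x\<^sub>i \<cdot> x\<^sub>j = x\<^bsub>j - i\<^esub>\<close>, so the
  axioms are identities for \<open>-\<close> on the natural numbers. For simplicity, an ideal containing some
  \<open>x\<^sub>i\<close> with \<open>i > 0\<close> contains \<open>x\<^bsub>i - 1\<^esub> \<cdot> x\<^sub>i = x\<^sub>1\<close>, and since \<open>x\<^sub>1 \<cdot> x\<^bsub>j + 1\<^esub> = x\<^sub>j\<close>,
  condition (I1) then climbs through all of the chain.\<close>

theorem proposition4p5:
  fixes n :: nat
    and x :: "nat \<Rightarrow> 'a"
    and mul :: "'a \<Rightarrow> 'a \<Rightarrow> 'a"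
    and A :: "'a set"
  assumes "n > 1"
    and "inj_on x {0..n - 1}"
    and "A = x ` {0..n - 1}"
    and "\<And>i j. i \<in> {0..n - 1} \<Longrightarrow> j \<in> {0..n - 1} \<Longrightarrow>
           mul (x i) (x j) = x (nat (max (int j - int i) 0))"
  shows "CKL_algebra A mul (x 0) \<and> linear_L_algebra A mul (x 0) \<and> simple_L_algebra A mul (x 0) \<and>
    (\<forall>i\<in>{0..n - 1}. \<forall>j\<in>{0..n - 1}. L_less mul (x 0) (x j) (x i) \<longleftrightarrow> i < j)"
proof -
  have mul: "mul (x i) (x j) = x (j - i)" if "i \<le> n - 1" "j \<le> n - 1" for i j
  proof -
    have "nat (max (int j - int i) 0) = j - i" by linarith
    with assms(4)[of i j] that show ?thesis by simp
  qed
  have x_eq: "x i = x j \<longleftrightarrow> i = j" if "i \<le> n - 1" "j \<le> n - 1" for i j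
    using assms(2) that by (auto dest: inj_onD)
  have x_in: "x i \<in> A" if "i \<le> n - 1" for i
    using assms(3) that by simp
  have A: "a \<in> A \<longleftrightarrow> (\<exists>i\<le>n - 1. a = x i)" for a
    using assms(3) by auto
  \<comment> \<open>The order runs against the indices: by injectivity the product is the unit
    exactly when the truncated difference \<open>j - i\<close> is 0.\<close>
  have le: "L_le mul (x 0) (x i) (x j) \<longleftrightarrow> j \<le> i" if "i \<le> n - 1" "j \<le> n - 1" for i j
    using that by (simp add: L_le_def mul x_eq)
  interpret L_algebra A mul "x 0"
  proof unfold_locales
    fix a b assume "a \<in> A" "b \<in> A"
    then obtain i j where "i \<le> n - 1" "j \<le> n - 1" "a = x i" "b = x j"
      using A by blast
    then show "mul a b \<in> A"
      by (simp add: mul x_in)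
  \<comment> \<open>In the cycloid law both sides have index \<open>k - max i j\<close>, which is
    symmetric in \<open>i\<close> and \<open>j\<close>.\<close>
  qed (auto simp: A mul x_eq)
  \<comment> \<open>Both sides of the exchange law have index \<open>k - (i + j)\<close>.\<close>
  have "CKL_algebra A mul (x 0)"
    by unfold_locales (auto simp: A mul add.commute)
  moreover have "linear_L_algebra A mul (x 0)"
  proof unfold_locales
    let ?r = "{(a, b). a \<in> A \<and> b \<in> A \<and> L_le mul (x 0) a b}"
    have "refl_on A ?r"
      by (auto simp: refl_on_def L_le_def mul_self)
    moreover have "trans ?r"
    proof (rule transI)
      fix a b c assume "(a, b) \<in> ?r" "(b, c) \<in> ?r"
      moreover from this obtain i j k where "a = x i" "b = x j" "c = x k"
          "i \<le> n - 1" "j \<le> n - 1" "k \<le> n - 1"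
        using A by blast
      ultimately show "(a, c) \<in> ?r"
        by (simp add: le)
    qed
    moreover have "antisym ?r"
      by (rule antisymI) (simp add: L_le_def mul_antisym)
    moreover have "total_on A ?r"
    proof (rule total_onI)
      fix a b assume "a \<in> A" "b \<in> A"
      moreover from this obtain i j where "a = x i" "b = x j" "i \<le> n - 1" "j \<le> n - 1"
        using A by blast
      ultimately show "(a, b) \<in> ?r \<or> (b, a) \<in> ?r"
        by (simp add: le nat_le_linear)
    qed
    ultimately show "linear_order_on A ?r"
      by (auto simp: linear_order_on_def partial_order_on_def preorder_on_def)
  qed
  moreover have "simple_L_algebra A mul (x 0)"
  proof unfold_locales
    fix I assume I: "L_ideal A mul I"
    then have "I \<noteq> {}" and sub: "I \<subseteq> A"
      and I1: "\<And>a b. a \<in> I \<Longrightarrow> b \<in> A \<Longrightarrow> mul a b \<in> I \<Longrightarrow> b \<in> I"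
      and I2: "\<And>a b. a \<in> I \<Longrightarrow> b \<in> A \<Longrightarrow> mul b a \<in> I"
      unfolding L_ideal_def by blast+
    \<comment> \<open>For any \<open>a\<close> in \<open>I\<close>, (I2) puts
      \<open>mul a a\<close>, the unit, into \<open>I\<close>.\<close>
    then have one_in: "x 0 \<in> I"
      using mul_self by (metis ex_in_conv subsetD)
    have "A \<subseteq> I" if "I \<noteq> {x 0}"
    proof -
      obtain a where "a \<in> I" "a \<noteq> x 0"
        using \<open>I \<noteq> {x 0}\<close> one_in by blast
      then obtain i where i: "i \<le> n - 1" "i > 0" "x i \<in> I"
        using sub by (metis A gr0I subsetD)
      \<comment> \<open>Since \<open>i > 0\<close>, the truncated \<open>i - (i - 1)\<close> is 1
        and not 0.\<close>
      have "mul (x (i - 1)) (x i) \<in> I"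
        using i by (simp add: I2 x_in)
      then have x1: "x 1 \<in> I"
        using i by (simp add: mul)
      have "x j \<in> I" if "j \<le> n - 1" for j
        using that
      proof (induction j)
        case 0
        show ?case by (fact one_in)
      next
        case (Suc j)
        \<comment> \<open>The product is \<open>x j\<close>, covered by the induction hypothesis;
          \<open>n > 1\<close> keeps index 1 in the range where \<open>mul\<close> is known.\<close>
        then have "mul (x 1) (x (Suc j)) \<in> I"
          using \<open>n > 1\<close> by (simp add: mul)
        then show ?case
          using I1 x1 x_in Suc.prems by blast
      qed
      then show ?thesis by (auto simp: A)
    qed
    with sub show "I = {x 0} \<or> I = A" by blast
  qed
  moreover have "\<forall>i\<in>{0..n - 1}. \<forall>j\<in>{0..n - 1}. L_less mul (x 0) (x j) (x i) \<longleftrightarrow> i < j"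
    by (auto simp: L_less_def le x_eq)
  ultimately show ?thesis by blast
qed

end
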